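(* Let $A$ be an anticommutative g-alternative algebra over a field $F$ with $\mathrm{Ann}(A)=0$. Then there exists an actor of $A$ in $\mathrm{gAlt}$, and $\mathrm{Act}(A)=\mathfrak{B}(A)$.
   Context: Algebras: an algebra over a field $F$ is an $F$-vector space with an $F$-bilinear multiplication, not assumed associative or unital. $A$ is g-alternative if for all $x,y,z\in A$: $x(yz)=(xy)z+(yx)z-y(xz)$ and $(xy)z=x(yz)+x(zy)-(xz)y$. $\mathrm{gAlt}$ is the category of g-alternative algebras over $F$. $A$ is anticommutative if $aa'=-a'a$ for all $a,a'\in A$. $\mathrm{Ann}(A)=\{z\in A\mid az=za=0\text{ for all }a\in A\}$. Derived actions: an action of an $F$-algebra $B$ on a g-alternative algebra $A$, i.e. a pair of $F$-bilinear maps $B\times A\to A$, $(b,a)\mapsto ba$, and $A\times B\to A$, $(a,b)\mapsto ab$, is a derived action in $\mathrm{gAlt}$ if $B$ is g-alternative and for all $a,a_1,a_2\in A$, $b,b_1,b_2\in B$: $b(a_1a_2)=(ba_1)a_2+(a_1b)a_2-a_1(ba_2)$; $(a_1a_2)b=a_1(a_2b)+a_1(ba_2)-(a_1b)a_2$; $(ba_1)a_2=b(a_1a_2)+b(a_2a_1)-(ba_2)a_1$; $a_1(a_2b)=(a_1a_2)b+(a_2a_1)b-a_2(a_1b)$; $(b_1b_2)a=b_1(b_2a)+b_1(ab_2)-(b_1a)b_2$; $a(b_1b_2)=(ab_1)b_2+(b_1a)b_2-b_1(ab_2)$; $(ab_1)b_2=a(b_1b_2)+a(b_2b_1)-(ab_2)b_1$;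 $b_1(b_2a)=(b_1b_2)a+(b_2b_1)a-b_2(b_1a)$. Let $\{B_i\}_{i\in I}$ be the family of all g-alternative algebras equipped with a derived action on $A$ in $\mathrm{gAlt}$. Actor: an actor of $A$ in $\mathrm{gAlt}$ is a g-alternative algebra $\mathrm{Act}(A)$ with a derived action on $A$ in $\mathrm{gAlt}$ such that for every g-alternative algebra $C$ with a derived action on $A$ there is a unique algebra homomorphism $\varphi\colon C\to\mathrm{Act}(A)$ with $ca=\varphi(c)a$ and $ac=a\varphi(c)$ for all $a\in A$, $c\in C$. $\mathfrak{B}(A)$: for a pair $f$ of $F$-linear maps $A\to A$ write $fa$ for the value of the first map at $a$ and $af$ for the value of the second. Each $b\in B_i$ gives the pair $(a\mapsto ba,\ a\mapsto ab)$; let $\mathbb{B}$ be the set of all pairs so obtained. On pairs define addition componentwise and a product $ff'$ by $(ff')a=f(f'a)+f(af')-(fa)f'$, $a(ff')=(af)f'+(fa)f'-f(af')$. Then $\mathfrak{B}(A)$ (the universal strict general actor of $A$) is the $F$-algebra of all pairs obtained from elements of $\mathbb{B}$ by repeatedly applying addition, negation and this product (pairs giving the same maps are identified). It acts on $A$ by $(f,a)\mapsto fa$, $(a,f)\mapsto af$. The equality $\mathrm{Act}(A)=\mathfrak{B}(A)$ means that $\mathfrak{B}(A)$ with this action is an actor of $A$. *)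

theory Defs
  imports "HOL-Algebra.Module"
begin

section \<open>Non-associative algebras and g-alternative algebras\<close>

definition bilinear_map ::
    "('f, 'n) ring_scheme \<Rightarrow> ('f, 'u, 'i) module_scheme \<Rightarrow> ('f, 'v, 'j) module_scheme \<Rightarrow>
     ('f, 'w, 'k) module_scheme \<Rightarrow> ('u \<Rightarrow> 'v \<Rightarrow> 'w) \<Rightarrow> bool" where
  "bilinear_map F U V W h \<longleftrightarrow>
     (\<forall>u\<in>carrier U. \<forall>v\<in>carrier V. h u v \<in> carrier W) \<and>
     (\<forall>u\<in>carrier U. \<forall>u'\<in>carrier U. \<forall>v\<in>carrier V. h (u \<oplus>\<^bsub>U\<^esub> u') v = h u v \<oplus>\<^bsub>W\<^esub> h u' v) \<and>
     (\<forall>u\<in>carrier U. \<forall>v\<in>carrier V. \<forall>v'\<in>carrier V. h u (v \<oplus>\<^bsub>V\<^esub> v') = h u v \<oplus>\<^bsub>W\<^esub> h u v') \<and>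
     (\<forall>k\<in>carrier F. \<forall>u\<in>carrier U. \<forall>v\<in>carrier V. h (k \<odot>\<^bsub>U\<^esub> u) v = k \<odot>\<^bsub>W\<^esub> h u v) \<and>
     (\<forall>k\<in>carrier F. \<forall>u\<in>carrier U. \<forall>v\<in>carrier V. h u (k \<odot>\<^bsub>V\<^esub> v) = k \<odot>\<^bsub>W\<^esub> h u v)"

text \<open>
  The multiplication of an algebra is the field \<open>mult\<close> of the record; the field \<open>one\<close> of the
  record carries no meaning.
\<close>

locale nonassoc_algebra = F: field F + A: module F A
  for F :: "('f, 'n) ring_scheme" (structure) and A :: "('f, 'a, 'm) module_scheme" (structure) +
  assumes mult_bilinear: "bilinear_map F A A A (\<lambda>x y. x \<otimes>\<^bsub>A\<^esub> y)"

locale galt_algebra = nonassoc_algebra F A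
  for F :: "('f, 'n) ring_scheme" (structure) and A :: "('f, 'a, 'm) module_scheme" (structure) +
  assumes galt1: "\<lbrakk>x \<in> carrier A; y \<in> carrier A; z \<in> carrier A\<rbrakk> \<Longrightarrow>
      x \<otimes>\<^bsub>A\<^esub> (y \<otimes>\<^bsub>A\<^esub> z) = (x \<otimes>\<^bsub>A\<^esub> y) \<otimes>\<^bsub>A\<^esub> z \<oplus>\<^bsub>A\<^esub> (y \<otimes>\<^bsub>A\<^esub> x) \<otimes>\<^bsub>A\<^esub> z \<ominus>\<^bsub>A\<^esub> y \<otimes>\<^bsub>A\<^esub> (x \<otimes>\<^bsub>A\<^esub> z)"
    and galt2: "\<lbrakk>x \<in> carrier A; y \<in> carrier A; z \<in> carrier A\<rbrakk> \<Longrightarrow>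
      (x \<otimes>\<^bsub>A\<^esub> y) \<otimes>\<^bsub>A\<^esub> z = x \<otimes>\<^bsub>A\<^esub> (y \<otimes>\<^bsub>A\<^esub> z) \<oplus>\<^bsub>A\<^esub> x \<otimes>\<^bsub>A\<^esub> (z \<otimes>\<^bsub>A\<^esub> y) \<ominus>\<^bsub>A\<^esub> (x \<otimes>\<^bsub>A\<^esub> z) \<otimes>\<^bsub>A\<^esub> y"

definition anticommutative :: "('a, 'm) ring_scheme \<Rightarrow> bool" where
  "anticommutative A \<longleftrightarrow>
     (\<forall>a\<in>carrier A. \<forall>a'\<in>carrier A. a \<otimes>\<^bsub>A\<^esub> a' = \<ominus>\<^bsub>A\<^esub> (a' \<otimes>\<^bsub>A\<^esub> a))"

definition Ann :: "('a, 'm) ring_scheme \<Rightarrow> 'a set" where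
  "Ann A = {z \<in> carrier A. \<forall>a\<in>carrier A. a \<otimes>\<^bsub>A\<^esub> z = \<zero>\<^bsub>A\<^esub> \<and> z \<otimes>\<^bsub>A\<^esub> a = \<zero>\<^bsub>A\<^esub>}"

definition algebra_hom ::
    "('f, 'n) ring_scheme \<Rightarrow> ('f, 'b, 'i) module_scheme \<Rightarrow> ('f, 'c, 'j) module_scheme \<Rightarrow> ('b \<Rightarrow> 'c) set" where
  "algebra_hom F B C = {\<phi>. \<phi> \<in> carrier B \<rightarrow> carrier C \<and>
     (\<forall>x\<in>carrier B. \<forall>y\<in>carrier B. \<phi> (x \<oplus>\<^bsub>B\<^esub> y) = \<phi> x \<oplus>\<^bsub>C\<^esub> \<phi> y) \<and>
     (\<forall>k\<in>carrier F. \<forall>x\<in>carrier B. \<phi> (k \<odot>\<^bsub>B\<^esub> x) = k \<odot>\<^bsub>C\<^esub> \<phi> x) \<and>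
     (\<forall>x\<in>carrier B. \<forall>y\<in>carrier B. \<phi> (x \<otimes>\<^bsub>B\<^esub> y) = \<phi> x \<otimes>\<^bsub>C\<^esub> \<phi> y)}"

section \<open>Derived actions and actors\<close>

text \<open>An action of \<open>B\<close> on \<open>A\<close>: \<open>l b a\<close> stands for $ba$ and \<open>r a b\<close> for $ab$.\<close>

locale derived_action = B: galt_algebra F B + A: galt_algebra F A
  for F :: "('f, 'n) ring_scheme" and B :: "('f, 'b, 'k) module_scheme"
    and A :: "('f, 'a, 'm) module_scheme"
    and l :: "'b \<Rightarrow> 'a \<Rightarrow> 'a" and r :: "'a \<Rightarrow> 'b \<Rightarrow> 'a" +
  assumes l_bilinear: "bilinear_map F B A A l"
    and r_bilinear: "bilinear_map F A B A r"
    and der1: "\<lbrakk>b \<in> carrier B; a1 \<in> carrier A; a2 \<in> carrier A\<rbrakk> \<Longrightarrow>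
      l b (a1 \<otimes>\<^bsub>A\<^esub> a2) = l b a1 \<otimes>\<^bsub>A\<^esub> a2 \<oplus>\<^bsub>A\<^esub> r a1 b \<otimes>\<^bsub>A\<^esub> a2 \<ominus>\<^bsub>A\<^esub> a1 \<otimes>\<^bsub>A\<^esub> l b a2"
    and der2: "\<lbrakk>b \<in> carrier B; a1 \<in> carrier A; a2 \<in> carrier A\<rbrakk> \<Longrightarrow>
      r (a1 \<otimes>\<^bsub>A\<^esub> a2) b = a1 \<otimes>\<^bsub>A\<^esub> r a2 b \<oplus>\<^bsub>A\<^esub> a1 \<otimes>\<^bsub>A\<^esub> l b a2 \<ominus>\<^bsub>A\<^esub> r a1 b \<otimes>\<^bsub>A\<^esub> a2"
    and der3: "\<lbrakk>b \<in> carrier B; a1 \<in> carrier A; a2 \<in> carrier A\<rbrakk> \<Longrightarrow>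
      l b a1 \<otimes>\<^bsub>A\<^esub> a2 = l b (a1 \<otimes>\<^bsub>A\<^esub> a2) \<oplus>\<^bsub>A\<^esub> l b (a2 \<otimes>\<^bsub>A\<^esub> a1) \<ominus>\<^bsub>A\<^esub> l b a2 \<otimes>\<^bsub>A\<^esub> a1"
    and der4: "\<lbrakk>b \<in> carrier B; a1 \<in> carrier A; a2 \<in> carrier A\<rbrakk> \<Longrightarrow>
      a1 \<otimes>\<^bsub>A\<^esub> r a2 b = r (a1 \<otimes>\<^bsub>A\<^esub> a2) b \<oplus>\<^bsub>A\<^esub> r (a2 \<otimes>\<^bsub>A\<^esub> a1) b \<ominus>\<^bsub>A\<^esub> a2 \<otimes>\<^bsub>A\<^esub> r a1 b"
    and der5: "\<lbrakk>a \<in> carrier A; b1 \<in> carrier B; b2 \<in> carrier B\<rbrakk> \<Longrightarrow>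
      l (b1 \<otimes>\<^bsub>B\<^esub> b2) a = l b1 (l b2 a) \<oplus>\<^bsub>A\<^esub> l b1 (r a b2) \<ominus>\<^bsub>A\<^esub> r (l b1 a) b2"
    and der6: "\<lbrakk>a \<in> carrier A; b1 \<in> carrier B; b2 \<in> carrier B\<rbrakk> \<Longrightarrow>
      r a (b1 \<otimes>\<^bsub>B\<^esub> b2) = r (r a b1) b2 \<oplus>\<^bsub>A\<^esub> r (l b1 a) b2 \<ominus>\<^bsub>A\<^esub> l b1 (r a b2)"
    and der7: "\<lbrakk>a \<in> carrier A; b1 \<in> carrier B; b2 \<in> carrier B\<rbrakk> \<Longrightarrow>
      r (r a b1) b2 = r a (b1 \<otimes>\<^bsub>B\<^esub> b2) \<oplus>\<^bsub>A\<^esub> r a (b2 \<otimes>\<^bsub>B\<^esub> b1) \<ominus>\<^bsub>A\<^esub> r (r a b2) b1"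
    and der8: "\<lbrakk>a \<in> carrier A; b1 \<in> carrier B; b2 \<in> carrier B\<rbrakk> \<Longrightarrow>
      l b1 (l b2 a) = l (b1 \<otimes>\<^bsub>B\<^esub> b2) a \<oplus>\<^bsub>A\<^esub> l (b2 \<otimes>\<^bsub>B\<^esub> b1) a \<ominus>\<^bsub>A\<^esub> l b2 (l b1 a)"

text \<open>
  The first argument fixes the type in which the test algebras \<open>C\<close> have their carriers. A theorem
  stating \<open>is_actor TYPE('c) F A Act l r\<close> for a free type variable \<open>'c\<close> ranges over all of them.
  Homomorphisms are compared on \<open>carrier C\<close> only, hence \<open>extensional\<close>.
\<close>

definition is_actor ::
    "'c itself \<Rightarrow> ('f, 'n) ring_scheme \<Rightarrow> ('f, 'a, 'm) module_scheme \<Rightarrow> ('f, 'b, 'k) module_scheme \<Rightarrow>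
     ('b \<Rightarrow> 'a \<Rightarrow> 'a) \<Rightarrow> ('a \<Rightarrow> 'b \<Rightarrow> 'a) \<Rightarrow> bool" where
  "is_actor _ F A Act l r \<longleftrightarrow>
     derived_action F Act A l r \<and>
     (\<forall>(C :: ('f, 'c) module) lC rC. derived_action F C A lC rC \<longrightarrow>
        (\<exists>!\<phi>. \<phi> \<in> algebra_hom F C Act \<inter> extensional (carrier C) \<and>
              (\<forall>c\<in>carrier C. \<forall>a\<in>carrier A. lC c a = l (\<phi> c) a \<and> rC a c = r a (\<phi> c))))"

section \<open>The universal strict general actor\<close>

text \<open>
  A pair of maps on \<open>carrier A\<close> is a pair \<open>f\<close> of extensional functions, so that pairs giving the
  same maps on \<open>carrier A\<close> are equal; \<open>fst f a\<close> stands for $fa$ and \<open>snd f a\<close> for $af$.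
\<close>

type_synonym 'a mpair = "('a \<Rightarrow> 'a) \<times> ('a \<Rightarrow> 'a)"

definition act_pair ::
    "('a, 'm) ring_scheme \<Rightarrow> ('b \<Rightarrow> 'a \<Rightarrow> 'a) \<Rightarrow> ('a \<Rightarrow> 'b \<Rightarrow> 'a) \<Rightarrow> 'b \<Rightarrow> 'a mpair" where
  "act_pair A l r b = (\<lambda>a\<in>carrier A. l b a, \<lambda>a\<in>carrier A. r a b)"

definition pair_zero :: "('a, 'm) ring_scheme \<Rightarrow> 'a mpair" where
  "pair_zero A = (\<lambda>a\<in>carrier A. \<zero>\<^bsub>A\<^esub>, \<lambda>a\<in>carrier A. \<zero>\<^bsub>A\<^esub>)"

definition pair_add :: "('a, 'm) ring_scheme \<Rightarrow> 'a mpair \<Rightarrow> 'a mpair \<Rightarrow> 'a mpair" where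
  "pair_add A f g =
     (\<lambda>a\<in>carrier A. fst f a \<oplus>\<^bsub>A\<^esub> fst g a, \<lambda>a\<in>carrier A. snd f a \<oplus>\<^bsub>A\<^esub> snd g a)"

definition pair_neg :: "('a, 'm) ring_scheme \<Rightarrow> 'a mpair \<Rightarrow> 'a mpair" where
  "pair_neg A f = (\<lambda>a\<in>carrier A. \<ominus>\<^bsub>A\<^esub> fst f a, \<lambda>a\<in>carrier A. \<ominus>\<^bsub>A\<^esub> snd f a)"

definition pair_smult :: "('f, 'a, 'm) module_scheme \<Rightarrow> 'f \<Rightarrow> 'a mpair \<Rightarrow> 'a mpair" where
  "pair_smult A k f = (\<lambda>a\<in>carrier A. k \<odot>\<^bsub>A\<^esub> fst f a, \<lambda>a\<in>carrier A. k \<odot>\<^bsub>A\<^esub> snd f a)"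

text \<open>$(fg)a = f(ga) + f(ag) - (fa)g$ and $a(fg) = (af)g + (fa)g - f(ag)$.\<close>

definition pair_mult :: "('a, 'm) ring_scheme \<Rightarrow> 'a mpair \<Rightarrow> 'a mpair \<Rightarrow> 'a mpair" where
  "pair_mult A f g =
     (\<lambda>a\<in>carrier A. fst f (fst g a) \<oplus>\<^bsub>A\<^esub> fst f (snd g a) \<ominus>\<^bsub>A\<^esub> snd g (fst f a),
      \<lambda>a\<in>carrier A. snd g (snd f a) \<oplus>\<^bsub>A\<^esub> snd g (fst f a) \<ominus>\<^bsub>A\<^esub> fst f (snd g a))"

text \<open>
  The set of all pairs induced by elements of g-alternative algebras with a derived action on \<open>A\<close>.
  A HOL set cannot range over algebras with carriers in arbitrary types, so the algebras \<open>B\<close> are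
  taken with carriers in the type of pairs. This loses nothing: see \<open>act_pair_in_induced_pairs\<close>
  below.
\<close>

definition induced_pairs ::
    "('f, 'n) ring_scheme \<Rightarrow> ('f, 'a, 'm) module_scheme \<Rightarrow> 'a mpair set" where
  "induced_pairs F A =
     {act_pair A l r b | (B :: ('f, 'a mpair) module) l r b. derived_action F B A l r \<and> b \<in> carrier B}"

inductive_set usga_carrier :: "('f, 'n) ring_scheme \<Rightarrow> ('f, 'a, 'm) module_scheme \<Rightarrow> 'a mpair set"
  for F :: "('f, 'n) ring_scheme" and A :: "('f, 'a, 'm) module_scheme" where
    base: "f \<in> induced_pairs F A \<Longrightarrow> f \<in> usga_carrier F A"
  | add: "\<lbrakk>f \<in> usga_carrier F A; g \<in> usga_carrier F A\<rbrakk> \<Longrightarrow> pair_add A f g \<in> usga_carrier F A"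
  | neg: "f \<in> usga_carrier F A \<Longrightarrow> pair_neg A f \<in> usga_carrier F A"
  | mult: "\<lbrakk>f \<in> usga_carrier F A; g \<in> usga_carrier F A\<rbrakk> \<Longrightarrow> pair_mult A f g \<in> usga_carrier F A"

definition usga ::
    "('f, 'n) ring_scheme \<Rightarrow> ('f, 'a, 'm) module_scheme \<Rightarrow> ('f, 'a mpair) module" where
  "usga F A = \<lparr>carrier = usga_carrier F A, mult = pair_mult A, one = undefined,
     zero = pair_zero A, add = pair_add A, smult = pair_smult A\<rparr>"

section \<open>Independence of the carrier type of the acting algebras\<close>

lemma galt_algebra_surj_image:
  fixes B :: "('f, 'b, 'k) module_scheme" and D :: "('f, 'd, 'j) module_scheme"
  assumes "galt_algebra F B"
    and surj: "carrier D = h ` carrier B"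
    and h0: "\<zero>\<^bsub>D\<^esub> = h \<zero>\<^bsub>B\<^esub>"
    and ha: "\<And>x y. \<lbrakk>x \<in> carrier B; y \<in> carrier B\<rbrakk> \<Longrightarrow> h x \<oplus>\<^bsub>D\<^esub> h y = h (x \<oplus>\<^bsub>B\<^esub> y)"
    and hm: "\<And>x y. \<lbrakk>x \<in> carrier B; y \<in> carrier B\<rbrakk> \<Longrightarrow> h x \<otimes>\<^bsub>D\<^esub> h y = h (x \<otimes>\<^bsub>B\<^esub> y)"
    and hs: "\<And>k x. \<lbrakk>k \<in> carrier F; x \<in> carrier B\<rbrakk> \<Longrightarrow> k \<odot>\<^bsub>D\<^esub> h x = h (k \<odot>\<^bsub>B\<^esub> x)"
  shows "galt_algebra F D"
proof -
  interpret B: galt_algebra F B by fact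
  have mc: "x \<otimes>\<^bsub>B\<^esub> y \<in> carrier B" if "x \<in> carrier B" "y \<in> carrier B" for x y
    using B.mult_bilinear that by (auto simp: bilinear_map_def)
  have ag: "abelian_group D"
  proof (rule abelian_groupI)
    fix x assume "x \<in> carrier D"
    then obtain u where u: "u \<in> carrier B" "x = h u" using surj by auto
    have "h (\<ominus>\<^bsub>B\<^esub> u) \<in> carrier D" "h (\<ominus>\<^bsub>B\<^esub> u) \<oplus>\<^bsub>D\<^esub> x = \<zero>\<^bsub>D\<^esub>"
      using u surj by (auto simp: ha h0 B.A.M.l_neg)
    then show "\<exists>y\<in>carrier D. y \<oplus>\<^bsub>D\<^esub> x = \<zero>\<^bsub>D\<^esub>" by blast
  qed (use surj in \<open>auto simp: h0 ha B.A.M.a_ac\<close>)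
  then interpret D: abelian_group D .
  have hn: "\<ominus>\<^bsub>D\<^esub> h x = h (\<ominus>\<^bsub>B\<^esub> x)" if "x \<in> carrier B" for x
    by (rule D.minus_equality) (use that surj in \<open>auto simp: ha h0 B.A.M.l_neg\<close>)
  have hd: "h x \<ominus>\<^bsub>D\<^esub> h y = h (x \<ominus>\<^bsub>B\<^esub> y)" if "x \<in> carrier B" "y \<in> carrier B" for x y
    using that by (simp add: a_minus_def hn ha)
  have mod: "module F D"
    by (rule moduleI)
      (use ag surj in \<open>auto simp: ha hs B.F.is_cring B.A.smult_l_distr B.A.smult_r_distr B.A.smult_assoc1\<close>)
  have bil: "bilinear_map F D D D (\<lambda>x y. x \<otimes>\<^bsub>D\<^esub> y)"
    using B.mult_bilinear surj by (auto simp: bilinear_map_def ha hm hs)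
  show ?thesis
  proof (intro galt_algebra.intro nonassoc_algebra.intro nonassoc_algebra_axioms.intro
      galt_algebra_axioms.intro)
    show "field F" by (rule B.F.field_axioms)
    fix x y z assume "x \<in> carrier D" "y \<in> carrier D" "z \<in> carrier D"
    then obtain u v w where *: "u \<in> carrier B" "v \<in> carrier B" "w \<in> carrier B"
      "x = h u" "y = h v" "z = h w" using surj by auto
    then show "x \<otimes>\<^bsub>D\<^esub> (y \<otimes>\<^bsub>D\<^esub> z) = (x \<otimes>\<^bsub>D\<^esub> y) \<otimes>\<^bsub>D\<^esub> z \<oplus>\<^bsub>D\<^esub> (y \<otimes>\<^bsub>D\<^esub> x) \<otimes>\<^bsub>D\<^esub> z \<ominus>\<^bsub>D\<^esub> y \<otimes>\<^bsub>D\<^esub> (x \<otimes>\<^bsub>D\<^esub> z)"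
      using B.galt1[of u v w] by (simp add: hm ha hd mc)
    show "(x \<otimes>\<^bsub>D\<^esub> y) \<otimes>\<^bsub>D\<^esub> z = x \<otimes>\<^bsub>D\<^esub> (y \<otimes>\<^bsub>D\<^esub> z) \<oplus>\<^bsub>D\<^esub> x \<otimes>\<^bsub>D\<^esub> (z \<otimes>\<^bsub>D\<^esub> y) \<ominus>\<^bsub>D\<^esub> (x \<otimes>\<^bsub>D\<^esub> z) \<otimes>\<^bsub>D\<^esub> y"
      using * B.galt2[of u v w] by (simp add: hm ha hd mc)
  qed (fact mod bil)+
qed

lemma act_pair_in_induced_pairs:
  fixes B :: "('f, 'b, 'k) module_scheme" and A :: "('f, 'a, 'm) module_scheme"
  assumes "derived_action F B A l r" and b: "b \<in> carrier B"
  shows "act_pair A l r b \<in> induced_pairs F A"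
proof -
  interpret derived_action F B A l r by fact
  let ?h = "act_pair A l r"
  define D :: "('f, 'a mpair) module" where
    "D = \<lparr>carrier = ?h ` carrier B, mult = pair_mult A, one = undefined,
          zero = ?h \<zero>\<^bsub>B\<^esub>, add = pair_add A, smult = pair_smult A\<rparr>"
  have lc: "l x a \<in> carrier A" and rc: "r a x \<in> carrier A" if "x \<in> carrier B" "a \<in> carrier A" for x a
    using l_bilinear r_bilinear that by (auto simp: bilinear_map_def)
  have ac: "x \<otimes>\<^bsub>A\<^esub> y \<in> carrier A" if "x \<in> carrier A" "y \<in> carrier A" for x y
    using A.mult_bilinear that by (auto simp: bilinear_map_def)
  have bc: "x \<otimes>\<^bsub>B\<^esub> y \<in> carrier B" if "x \<in> carrier B" "y \<in> carrier B" for x y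
    using B.mult_bilinear that by (auto simp: bilinear_map_def)
  have f: "fst (?h x) a = l x a" and s: "snd (?h x) a = r a x" if "a \<in> carrier A" for x a
    using that by (auto simp: act_pair_def)
  have ha: "pair_add A (?h x) (?h y) = ?h (x \<oplus>\<^bsub>B\<^esub> y)" if "x \<in> carrier B" "y \<in> carrier B" for x y
    using l_bilinear r_bilinear that
    by (auto simp: pair_add_def act_pair_def bilinear_map_def intro!: restrict_ext)
  have hs: "pair_smult A k (?h x) = ?h (k \<odot>\<^bsub>B\<^esub> x)" if "k \<in> carrier F" "x \<in> carrier B" for k x
    using l_bilinear r_bilinear that
    by (auto simp: pair_smult_def act_pair_def bilinear_map_def intro!: restrict_ext)
  have hm: "pair_mult A (?h x) (?h y) = ?h (x \<otimes>\<^bsub>B\<^esub> y)" if "x \<in> carrier B" "y \<in> carrier B" for x y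
    using that der5[of _ x y] der6[of _ x y]
    by (auto simp: pair_mult_def act_pair_def lc rc intro!: restrict_ext)
  have D: "galt_algebra F D"
    by (rule galt_algebra_surj_image[of F B D ?h])
      (auto simp: D_def ha hs hm B.galt_algebra_axioms)
  have "derived_action F D A fst (\<lambda>a p. snd p a)"
  proof (intro derived_action.intro derived_action_axioms.intro D A.galt_algebra_axioms)
    show "bilinear_map F D A A fst" "bilinear_map F A D A (\<lambda>a p. snd p a)"
      using l_bilinear r_bilinear by (auto simp: bilinear_map_def D_def ha hs f s)
  qed (auto simp: D_def hm f s lc rc ac bc intro: der1 der2 der3 der4 der5 der6 der7 der8)
  moreover have "?h b = act_pair A fst (\<lambda>a p. snd p a) (?h b)"
    by (auto simp: act_pair_def intro!: restrict_ext)
  moreover have "?h b \<in> carrier D" using b by (simp add: D_def)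
  ultimately show ?thesis unfolding induced_pairs_def by blast
qed

end

theory Submission
  imports Defs
begin

text \<open>
  Anticommutativity turns the g-alternative identities into $x(yz) = -y(xz)$, so $x(yz)$ is totally
  antisymmetric. For an element acting on the left by $L$ and on the right by $R$ the derived action
  identities become $L(xy) = (Rx)y = x(Ry)$ and $R(xy) = (Lx)y = x(Ly)$; evaluating $L(x(yz))$ in two
  ways gives $(Lx)(yz) = (Rx)(yz)$, so $L = R$ because the annihilator vanishes. Hence derived actions
  are by elements of the centroid, which is a commutative associative algebra under composition when
  the annihilator vanishes, and conversely this algebra has a derived action on $A$. So
  $\mathfrak{B}(A)$ is the centroid, and every derived action factors uniquely through it.
\<close>

section \<open>Cancellation in abelian groups and consequences of bilinearity\<close>

context abelian_group
begin

text \<open>The g-alternative identities and the conditions on a derived action all have the shape w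
  = p + q - s. For the centroid, s agrees with p or with q, and these two rules finish the
  verification.\<close>

lemma a_minus_cancel_right [simp]:
  "\<lbrakk>x \<in> carrier G; y \<in> carrier G\<rbrakk> \<Longrightarrow> x \<oplus> y \<ominus> y = x"
  by (simp add: a_minus_def a_assoc r_neg)

lemma a_minus_cancel_left [simp]:
  "\<lbrakk>x \<in> carrier G; y \<in> carrier G\<rbrakk> \<Longrightarrow> x \<oplus> y \<ominus> x = y"
  by (simp add: a_comm[of x y])

end

context nonassoc_algebra
begin

lemma mult_closed [simp]:
  "\<lbrakk>x \<in> carrier A; y \<in> carrier A\<rbrakk> \<Longrightarrow> x \<otimes>\<^bsub>A\<^esub> y \<in> carrier A"
  using mult_bilinear by (auto simp: bilinear_map_def)

lemma add_mult:
  "\<lbrakk>x \<in> carrier A; y \<in> carrier A; z \<in> carrier A\<rbrakk> \<Longrightarrow>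
    (x \<oplus>\<^bsub>A\<^esub> y) \<otimes>\<^bsub>A\<^esub> z = x \<otimes>\<^bsub>A\<^esub> z \<oplus>\<^bsub>A\<^esub> y \<otimes>\<^bsub>A\<^esub> z"
  using mult_bilinear by (auto simp: bilinear_map_def)

lemma mult_add:
  "\<lbrakk>x \<in> carrier A; y \<in> carrier A; z \<in> carrier A\<rbrakk> \<Longrightarrow>
    x \<otimes>\<^bsub>A\<^esub> (y \<oplus>\<^bsub>A\<^esub> z) = x \<otimes>\<^bsub>A\<^esub> y \<oplus>\<^bsub>A\<^esub> x \<otimes>\<^bsub>A\<^esub> z"
  using mult_bilinear by (auto simp: bilinear_map_def)

lemma smult_mult:
  "\<lbrakk>k \<in> carrier F; x \<in> carrier A; y \<in> carrier A\<rbrakk> \<Longrightarrow>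
    (k \<odot>\<^bsub>A\<^esub> x) \<otimes>\<^bsub>A\<^esub> y = k \<odot>\<^bsub>A\<^esub> (x \<otimes>\<^bsub>A\<^esub> y)"
  using mult_bilinear by (auto simp: bilinear_map_def)

lemma mult_smult:
  "\<lbrakk>k \<in> carrier F; x \<in> carrier A; y \<in> carrier A\<rbrakk> \<Longrightarrow>
    x \<otimes>\<^bsub>A\<^esub> (k \<odot>\<^bsub>A\<^esub> y) = k \<odot>\<^bsub>A\<^esub> (x \<otimes>\<^bsub>A\<^esub> y)"
  using mult_bilinear by (auto simp: bilinear_map_def)

text \<open>Stated for any additive self-map of the carrier, so that it serves multiplication by a
  fixed element as well as the two maps by which an element acts.\<close>

lemma additive_zero:
  assumes "T \<in> carrier A \<rightarrow> carrier A"
    and "\<And>x y. \<lbrakk>x \<in> carrier A; y \<in> carrier A\<rbrakk> \<Longrightarrow> T (x \<oplus>\<^bsub>A\<^esub> y) = T x \<oplus>\<^bsub>A\<^esub> T y"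
  shows "T \<zero>\<^bsub>A\<^esub> = \<zero>\<^bsub>A\<^esub>"
proof -
  have "T \<zero>\<^bsub>A\<^esub> \<oplus>\<^bsub>A\<^esub> T \<zero>\<^bsub>A\<^esub> = T \<zero>\<^bsub>A\<^esub>" using assms(2)[of "\<zero>\<^bsub>A\<^esub>" "\<zero>\<^bsub>A\<^esub>"] by simp
  moreover have "T \<zero>\<^bsub>A\<^esub> \<in> carrier A" using assms(1) by auto
  ultimately show ?thesis by (metis A.M.add.l_cancel_one)
qed

lemma additive_neg:
  assumes "T \<in> carrier A \<rightarrow> carrier A"
    and "\<And>x y. \<lbrakk>x \<in> carrier A; y \<in> carrier A\<rbrakk> \<Longrightarrow> T (x \<oplus>\<^bsub>A\<^esub> y) = T x \<oplus>\<^bsub>A\<^esub> T y"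
    and "x \<in> carrier A"
  shows "T (\<ominus>\<^bsub>A\<^esub> x) = \<ominus>\<^bsub>A\<^esub> T x"
proof -
  have "T (\<ominus>\<^bsub>A\<^esub> x) \<oplus>\<^bsub>A\<^esub> T x = T (\<ominus>\<^bsub>A\<^esub> x \<oplus>\<^bsub>A\<^esub> x)"
    using assms(2)[of "\<ominus>\<^bsub>A\<^esub> x" x] assms(3) by simp
  also have "\<dots> = \<zero>\<^bsub>A\<^esub>"
    using assms(3) additive_zero[OF assms(1,2)] by (simp add: A.M.l_neg)
  finally have "T (\<ominus>\<^bsub>A\<^esub> x) \<oplus>\<^bsub>A\<^esub> T x = \<zero>\<^bsub>A\<^esub>" .
  then have "\<ominus>\<^bsub>A\<^esub> T x = T (\<ominus>\<^bsub>A\<^esub> x)"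
    by (rule A.M.minus_equality) (use assms(1,3) in auto)
  then show ?thesis by simp
qed

lemma zero_mult [simp]: "x \<in> carrier A \<Longrightarrow> \<zero>\<^bsub>A\<^esub> \<otimes>\<^bsub>A\<^esub> x = \<zero>\<^bsub>A\<^esub>"
  by (rule additive_zero[of "\<lambda>z. z \<otimes>\<^bsub>A\<^esub> x"]) (auto simp: add_mult)

lemma mult_zero [simp]: "x \<in> carrier A \<Longrightarrow> x \<otimes>\<^bsub>A\<^esub> \<zero>\<^bsub>A\<^esub> = \<zero>\<^bsub>A\<^esub>"
  by (rule additive_zero[of "\<lambda>z. x \<otimes>\<^bsub>A\<^esub> z"]) (auto simp: mult_add)

lemma neg_mult [simp]:
  "\<lbrakk>x \<in> carrier A; y \<in> carrier A\<rbrakk> \<Longrightarrow> (\<ominus>\<^bsub>A\<^esub> x) \<otimes>\<^bsub>A\<^esub> y = \<ominus>\<^bsub>A\<^esub> (x \<otimes>\<^bsub>A\<^esub> y)"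
  by (rule additive_neg[of "\<lambda>z. z \<otimes>\<^bsub>A\<^esub> y"]) (auto simp: add_mult)

lemma mult_neg [simp]:
  "\<lbrakk>x \<in> carrier A; y \<in> carrier A\<rbrakk> \<Longrightarrow> x \<otimes>\<^bsub>A\<^esub> (\<ominus>\<^bsub>A\<^esub> y) = \<ominus>\<^bsub>A\<^esub> (x \<otimes>\<^bsub>A\<^esub> y)"
  by (rule additive_neg[of "\<lambda>z. x \<otimes>\<^bsub>A\<^esub> z"]) (auto simp: mult_add)

lemma smult_left_commute:
  "\<lbrakk>j \<in> carrier F; k \<in> carrier F; x \<in> carrier A\<rbrakk> \<Longrightarrow>
    j \<odot>\<^bsub>A\<^esub> (k \<odot>\<^bsub>A\<^esub> x) = k \<odot>\<^bsub>A\<^esub> (j \<odot>\<^bsub>A\<^esub> x)"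
  by (simp add: F.m_comm[of j k] flip: A.smult_assoc1)

end

section \<open>The centroid of a non-associative algebra\<close>

text \<open>Members are extensional, so that they are equal once they agree on the carrier and can
  serve directly as components of an \<open>mpair\<close>.\<close>

definition centroid ::
    "('f, 'n) ring_scheme \<Rightarrow> ('f, 'a, 'm) module_scheme \<Rightarrow> ('a \<Rightarrow> 'a) set" where
  "centroid F A = {T \<in> carrier A \<rightarrow>\<^sub>E carrier A.
     (\<forall>x\<in>carrier A. \<forall>y\<in>carrier A. T (x \<oplus>\<^bsub>A\<^esub> y) = T x \<oplus>\<^bsub>A\<^esub> T y) \<and>
     (\<forall>k\<in>carrier F. \<forall>x\<in>carrier A. T (k \<odot>\<^bsub>A\<^esub> x) = k \<odot>\<^bsub>A\<^esub> T x) \<and>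
     (\<forall>x\<in>carrier A. \<forall>y\<in>carrier A. T (x \<otimes>\<^bsub>A\<^esub> y) = T x \<otimes>\<^bsub>A\<^esub> y) \<and>
     (\<forall>x\<in>carrier A. \<forall>y\<in>carrier A. T (x \<otimes>\<^bsub>A\<^esub> y) = x \<otimes>\<^bsub>A\<^esub> T y)}"

context nonassoc_algebra
begin

text \<open>The two product rules are oriented so that rewriting moves \<open>T\<close> out of a
  product; terms with \<open>T\<close> in either factor then get the same normal form.\<close>

lemma centroidD:
  assumes "T \<in> centroid F A"
  shows "x \<in> carrier A \<Longrightarrow> T x \<in> carrier A"
    and "\<lbrakk>x \<in> carrier A; y \<in> carrier A\<rbrakk> \<Longrightarrow> T (x \<oplus>\<^bsub>A\<^esub> y) = T x \<oplus>\<^bsub>A\<^esub> T y"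
    and "\<lbrakk>k \<in> carrier F; x \<in> carrier A\<rbrakk> \<Longrightarrow> T (k \<odot>\<^bsub>A\<^esub> x) = k \<odot>\<^bsub>A\<^esub> T x"
    and "\<lbrakk>x \<in> carrier A; y \<in> carrier A\<rbrakk> \<Longrightarrow> T x \<otimes>\<^bsub>A\<^esub> y = T (x \<otimes>\<^bsub>A\<^esub> y)"
    and "\<lbrakk>x \<in> carrier A; y \<in> carrier A\<rbrakk> \<Longrightarrow> x \<otimes>\<^bsub>A\<^esub> T y = T (x \<otimes>\<^bsub>A\<^esub> y)"
    and "T \<in> extensional (carrier A)"
  using assms by (auto simp: centroid_def PiE_def)

lemma restrict_in_centroid:
  assumes "\<And>x. x \<in> carrier A \<Longrightarrow> T x \<in> carrier A"
    and "\<And>x y. \<lbrakk>x \<in> carrier A; y \<in> carrier A\<rbrakk> \<Longrightarrow> T (x \<oplus>\<^bsub>A\<^esub> y) = T x \<oplus>\<^bsub>A\<^esub> T y"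
    and "\<And>k x. \<lbrakk>k \<in> carrier F; x \<in> carrier A\<rbrakk> \<Longrightarrow> T (k \<odot>\<^bsub>A\<^esub> x) = k \<odot>\<^bsub>A\<^esub> T x"
    and "\<And>x y. \<lbrakk>x \<in> carrier A; y \<in> carrier A\<rbrakk> \<Longrightarrow> T (x \<otimes>\<^bsub>A\<^esub> y) = T x \<otimes>\<^bsub>A\<^esub> y"
    and "\<And>x y. \<lbrakk>x \<in> carrier A; y \<in> carrier A\<rbrakk> \<Longrightarrow> T (x \<otimes>\<^bsub>A\<^esub> y) = x \<otimes>\<^bsub>A\<^esub> T y"
  shows "restrict T (carrier A) \<in> centroid F A"
  using assms by (auto simp: centroid_def)

lemma centroid_zero: "(\<lambda>a\<in>carrier A. \<zero>\<^bsub>A\<^esub>) \<in> centroid F A"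
  by (rule restrict_in_centroid) auto

lemma centroid_add:
  assumes "S \<in> centroid F A" and "T \<in> centroid F A"
  shows "(\<lambda>a\<in>carrier A. S a \<oplus>\<^bsub>A\<^esub> T a) \<in> centroid F A"
  using centroidD(1-5)[OF assms(1)] centroidD(1-5)[OF assms(2)]
  by (intro restrict_in_centroid)
    (auto simp: A.M.a_ac A.smult_r_distr add_mult mult_add)

lemma centroid_uminus:
  assumes "T \<in> centroid F A"
  shows "(\<lambda>a\<in>carrier A. \<ominus>\<^bsub>A\<^esub> T a) \<in> centroid F A"
  using centroidD(1-5)[OF assms]
  by (intro restrict_in_centroid)
    (auto simp: A.M.minus_add A.M.a_comm A.smult_r_minus)

lemma centroid_smult:
  assumes "k \<in> carrier F" and "T \<in> centroid F A"
  shows "(\<lambda>a\<in>carrier A. k \<odot>\<^bsub>A\<^esub> T a) \<in> centroid F A"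
  using assms(1) centroidD(1-5)[OF assms(2)]
  by (intro restrict_in_centroid)
    (auto simp: A.smult_r_distr smult_mult mult_smult smult_left_commute)

lemma centroid_comp:
  assumes "S \<in> centroid F A" and "T \<in> centroid F A"
  shows "(\<lambda>a\<in>carrier A. S (T a)) \<in> centroid F A"
  using centroidD(1-5)[OF assms(1)] centroidD(1-5)[OF assms(2)]
  by (intro restrict_in_centroid) auto

end

section \<open>Antisymmetry and cancellation\<close>

locale centreless_anticommutative_galt_algebra = galt_algebra F A
  for F :: "('f, 'n) ring_scheme" (structure) and A :: "('f, 'a, 'm) module_scheme" (structure) +
  assumes anticomm: "anticommutative A"
    and Ann_trivial: "Ann A = {\<zero>\<^bsub>A\<^esub>}"
begin

lemma mult_anticomm:
  "\<lbrakk>x \<in> carrier A; y \<in> carrier A\<rbrakk> \<Longrightarrow> x \<otimes>\<^bsub>A\<^esub> y = \<ominus>\<^bsub>A\<^esub> (y \<otimes>\<^bsub>A\<^esub> x)"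
  using anticomm unfolding anticommutative_def by blast

lemma mult_add_swap:
  "\<lbrakk>x \<in> carrier A; y \<in> carrier A\<rbrakk> \<Longrightarrow> x \<otimes>\<^bsub>A\<^esub> y \<oplus>\<^bsub>A\<^esub> y \<otimes>\<^bsub>A\<^esub> x = \<zero>\<^bsub>A\<^esub>"
  by (simp add: mult_anticomm[of x y] A.M.l_neg)

text \<open>In \<open>galt1\<close> the two terms (xy)z + (yx)z add up to (xy + yx)z, which vanishes
  by anticommutativity.\<close>

lemma mult_left_swap:
  assumes "x \<in> carrier A" "y \<in> carrier A" "z \<in> carrier A"
  shows "x \<otimes>\<^bsub>A\<^esub> (y \<otimes>\<^bsub>A\<^esub> z) = \<ominus>\<^bsub>A\<^esub> (y \<otimes>\<^bsub>A\<^esub> (x \<otimes>\<^bsub>A\<^esub> z))"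
  using galt1[OF assms] assms
  by (simp add: a_minus_def mult_add_swap flip: add_mult)

text \<open>The difference u - v annihilates \<open>A\<close> from the left by assumption and from
  the right by anticommutativity, hence lies in \<open>Ann A\<close>.\<close>

lemma mult_right_cancel:
  assumes u: "u \<in> carrier A" and v: "v \<in> carrier A"
    and eq: "\<And>y. y \<in> carrier A \<Longrightarrow> u \<otimes>\<^bsub>A\<^esub> y = v \<otimes>\<^bsub>A\<^esub> y"
  shows "u = v"
proof -
  have left: "(u \<ominus>\<^bsub>A\<^esub> v) \<otimes>\<^bsub>A\<^esub> y = \<zero>\<^bsub>A\<^esub>" if "y \<in> carrier A" for y
    using that u v eq[OF that] by (simp add: a_minus_def add_mult A.M.r_neg)
  have "y \<otimes>\<^bsub>A\<^esub> (u \<ominus>\<^bsub>A\<^esub> v) = \<zero>\<^bsub>A\<^esub>" if "y \<in> carrier A" for y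
    using mult_anticomm[of y "u \<ominus>\<^bsub>A\<^esub> v"] left[OF that] that u v by simp
  with left have "u \<ominus>\<^bsub>A\<^esub> v \<in> Ann A" using u v by (simp add: Ann_def)
  then have zero: "u \<ominus>\<^bsub>A\<^esub> v = \<zero>\<^bsub>A\<^esub>" using Ann_trivial by simp
  have "u = (u \<ominus>\<^bsub>A\<^esub> v) \<oplus>\<^bsub>A\<^esub> v"
    using u v by (simp add: a_minus_def A.M.a_assoc A.M.l_neg)
  also have "\<dots> = v" using v by (simp add: zero)
  finally show ?thesis .
qed

text \<open>Anticommutativity and \<open>mult_left_swap\<close> give (uz)y = u(yz). Thus
  \<open>mult_right_cancel\<close> removes first y and then z.\<close>

lemma mult_mult_right_cancel:
  assumes u: "u \<in> carrier A" and v: "v \<in> carrier A"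
    and eq: "\<And>y z. \<lbrakk>y \<in> carrier A; z \<in> carrier A\<rbrakk> \<Longrightarrow> u \<otimes>\<^bsub>A\<^esub> (y \<otimes>\<^bsub>A\<^esub> z) = v \<otimes>\<^bsub>A\<^esub> (y \<otimes>\<^bsub>A\<^esub> z)"
  shows "u = v"
proof (rule mult_right_cancel[OF u v])
  fix z assume z: "z \<in> carrier A"
  show "u \<otimes>\<^bsub>A\<^esub> z = v \<otimes>\<^bsub>A\<^esub> z"
  proof (rule mult_right_cancel)
    fix y assume y: "y \<in> carrier A"
    have "u \<otimes>\<^bsub>A\<^esub> z \<otimes>\<^bsub>A\<^esub> y = u \<otimes>\<^bsub>A\<^esub> (y \<otimes>\<^bsub>A\<^esub> z)"
      using mult_anticomm[of "u \<otimes>\<^bsub>A\<^esub> z" y] mult_left_swap[of u y z] u y z by simp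
    moreover have "v \<otimes>\<^bsub>A\<^esub> z \<otimes>\<^bsub>A\<^esub> y = v \<otimes>\<^bsub>A\<^esub> (y \<otimes>\<^bsub>A\<^esub> z)"
      using mult_anticomm[of "v \<otimes>\<^bsub>A\<^esub> z" y] mult_left_swap[of v y z] v y z by simp
    ultimately show "u \<otimes>\<^bsub>A\<^esub> z \<otimes>\<^bsub>A\<^esub> y = v \<otimes>\<^bsub>A\<^esub> z \<otimes>\<^bsub>A\<^esub> y"
      using eq[OF y z] by simp
  qed (use u v z in auto)
qed

text \<open>In the product of S(Tx) with y, S can be shifted to y, T taken out of the product, and S
  returned to x inside T. Cancelling y gives the claim.\<close>

lemma centroid_commute:
  assumes S: "S \<in> centroid F A" and T: "T \<in> centroid F A" and x: "x \<in> carrier A"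
  shows "S (T x) = T (S x)"
proof (rule mult_right_cancel)
  fix y assume y: "y \<in> carrier A"
  note cS = centroidD[OF S] and cT = centroidD[OF T]
  have "S (T x) \<otimes>\<^bsub>A\<^esub> y = T x \<otimes>\<^bsub>A\<^esub> S y"
    using x y by (simp add: cS(4,5) cT(1))
  also have "\<dots> = T (S x) \<otimes>\<^bsub>A\<^esub> y"
    \<comment> \<open>The rule \<open>cS(5)\<close> is instantiated so that it applies only after T
      has been taken out. Both sides then become T(S(xy)); the general rule could also put S outside
      T.\<close>
    using x y by (simp add: cS(1,4) cS(5)[OF x y] cT(4))
  finally show "S (T x) \<otimes>\<^bsub>A\<^esub> y = T (S x) \<otimes>\<^bsub>A\<^esub> y" .
qed (use centroidD(1)[OF S] centroidD(1)[OF T] x in auto)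

section \<open>The centroid as an algebra acting on \<open>A\<close>\<close>

text \<open>All operations are inherited from \<open>usga F A\<close> and only the carrier is
  replaced, by diagonal pairs. Identifying the two algebras thus comes down to comparing
  carriers.\<close>

definition centroid_algebra :: "('f, 'a mpair) module" where
  "centroid_algebra = usga F A\<lparr>carrier := (\<lambda>T. (T, T)) ` centroid F A\<rparr>"

text \<open>Each component is twice one composite of S and T minus the composite in the other order.
  Since S and T commute, a single composition remains.\<close>

lemma centroid_pair_mult:
  assumes "S \<in> centroid F A" and "T \<in> centroid F A"
  shows "pair_mult A (S, S) (T, T) = (\<lambda>a\<in>carrier A. S (T a), \<lambda>a\<in>carrier A. S (T a))"
  using centroidD(1)[OF assms(1)] centroidD(1)[OF assms(2)] centroid_commute[OF assms]
  by (auto simp: pair_mult_def intro!: restrict_ext)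

lemma centroid_algebra_simps [simp]:
  "carrier centroid_algebra = (\<lambda>T. (T, T)) ` centroid F A"
  "\<zero>\<^bsub>centroid_algebra\<^esub> = (\<lambda>a\<in>carrier A. \<zero>\<^bsub>A\<^esub>, \<lambda>a\<in>carrier A. \<zero>\<^bsub>A\<^esub>)"
  "(S, S) \<oplus>\<^bsub>centroid_algebra\<^esub> (T, T) =
     (\<lambda>a\<in>carrier A. S a \<oplus>\<^bsub>A\<^esub> T a, \<lambda>a\<in>carrier A. S a \<oplus>\<^bsub>A\<^esub> T a)"
  "k \<odot>\<^bsub>centroid_algebra\<^esub> (T, T) = (\<lambda>a\<in>carrier A. k \<odot>\<^bsub>A\<^esub> T a, \<lambda>a\<in>carrier A. k \<odot>\<^bsub>A\<^esub> T a)"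
  "\<lbrakk>S \<in> centroid F A; T \<in> centroid F A\<rbrakk> \<Longrightarrow> (S, S) \<otimes>\<^bsub>centroid_algebra\<^esub> (T, T) =
     (\<lambda>a\<in>carrier A. S (T a), \<lambda>a\<in>carrier A. S (T a))"
  by (simp_all add: centroid_algebra_def usga_def pair_zero_def pair_add_def pair_smult_def
      centroid_pair_mult)

lemma centroid_restrict: "T \<in> centroid F A \<Longrightarrow> restrict T (carrier A) = T"
  by (simp add: centroidD(6) extensional_restrict)

lemma centroid_algebra_abelian_group: "abelian_group centroid_algebra"
proof (rule abelian_groupI)
  fix f assume "f \<in> carrier centroid_algebra"
  then obtain T where T: "T \<in> centroid F A" "f = (T, T)" by auto
  let ?N = "\<lambda>a\<in>carrier A. \<ominus>\<^bsub>A\<^esub> T a"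
  have "(?N, ?N) \<oplus>\<^bsub>centroid_algebra\<^esub> f = \<zero>\<^bsub>centroid_algebra\<^esub>"
    using centroidD(1)[OF T(1)] by (simp add: T(2) A.M.l_neg cong: restrict_cong)
  moreover have "(?N, ?N) \<in> carrier centroid_algebra"
    using centroid_uminus[OF T(1)] by simp
  ultimately show "\<exists>g\<in>carrier centroid_algebra. g \<oplus>\<^bsub>centroid_algebra\<^esub> f = \<zero>\<^bsub>centroid_algebra\<^esub>"
    by blast
qed (auto simp: centroid_zero centroid_add centroidD(1) A.M.a_ac centroid_restrict
    cong: restrict_cong)

text \<open>The product is composition, hence associative, and in an associative algebra both
  g-alternative identities read p = p + q - q.\<close>

lemma centroid_algebra_galt: "galt_algebra F centroid_algebra"
proof -
  interpret C: abelian_group centroid_algebra by (rule centroid_algebra_abelian_group)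
  have closed: "x \<otimes>\<^bsub>centroid_algebra\<^esub> y \<in> carrier centroid_algebra"
    if "x \<in> carrier centroid_algebra" "y \<in> carrier centroid_algebra" for x y
    using that by (auto simp: centroid_comp)
  have assoc: "x \<otimes>\<^bsub>centroid_algebra\<^esub> (y \<otimes>\<^bsub>centroid_algebra\<^esub> z) =
      (x \<otimes>\<^bsub>centroid_algebra\<^esub> y) \<otimes>\<^bsub>centroid_algebra\<^esub> z"
    if "x \<in> carrier centroid_algebra" "y \<in> carrier centroid_algebra" "z \<in> carrier centroid_algebra"
    for x y z
    using that by (auto simp: centroid_comp centroidD(1) intro!: restrict_ext)
  show ?thesis
  proof (intro galt_algebra.intro nonassoc_algebra.intro nonassoc_algebra_axioms.intro
      galt_algebra_axioms.intro)
    show "field F" by (rule F.field_axioms)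
    show "module F centroid_algebra"
      by (rule moduleI)
        (auto simp: C.abelian_group_axioms F.is_cring centroid_smult centroidD(1) centroid_add
          centroid_restrict A.smult_l_distr A.smult_r_distr A.smult_assoc1 cong: restrict_cong)
    show "bilinear_map F centroid_algebra centroid_algebra centroid_algebra
        (\<lambda>x y. x \<otimes>\<^bsub>centroid_algebra\<^esub> y)"
      by (auto simp: bilinear_map_def centroid_comp centroid_add centroid_smult
          centroidD(1-3) intro!: restrict_ext)
  qed (simp_all only: assoc closed C.a_minus_cancel_left C.a_minus_cancel_right)
qed

text \<open>A centroid map moves freely out of products, which settles the four conditions with one
  acting element. Those with two acting elements follow from commutativity of composition.\<close>

lemma centroid_algebra_derived_action:
  "derived_action F centroid_algebra A fst (\<lambda>a f. snd f a)"
proof (intro derived_action.intro derived_action_axioms.intro centroid_algebra_galt galt_algebra_axioms)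
  show "bilinear_map F centroid_algebra A A fst"
    and "bilinear_map F A centroid_algebra A (\<lambda>a f. snd f a)"
    by (auto simp: bilinear_map_def centroidD(1-3))
next
  fix f x y assume "f \<in> carrier centroid_algebra" and x: "x \<in> carrier A" and y: "y \<in> carrier A"
  then obtain T where T: "T \<in> centroid F A" and f: "f = (T, T)" by auto
  note c = centroidD(1,4,5)[OF T]
  show "fst f (x \<otimes>\<^bsub>A\<^esub> y) =
      fst f x \<otimes>\<^bsub>A\<^esub> y \<oplus>\<^bsub>A\<^esub> snd f x \<otimes>\<^bsub>A\<^esub> y \<ominus>\<^bsub>A\<^esub> x \<otimes>\<^bsub>A\<^esub> fst f y"
    and "snd f (x \<otimes>\<^bsub>A\<^esub> y) =
      x \<otimes>\<^bsub>A\<^esub> snd f y \<oplus>\<^bsub>A\<^esub> x \<otimes>\<^bsub>A\<^esub> fst f y \<ominus>\<^bsub>A\<^esub> snd f x \<otimes>\<^bsub>A\<^esub> y"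
    and "fst f x \<otimes>\<^bsub>A\<^esub> y =
      fst f (x \<otimes>\<^bsub>A\<^esub> y) \<oplus>\<^bsub>A\<^esub> fst f (y \<otimes>\<^bsub>A\<^esub> x) \<ominus>\<^bsub>A\<^esub> fst f y \<otimes>\<^bsub>A\<^esub> x"
    and "x \<otimes>\<^bsub>A\<^esub> snd f y =
      snd f (x \<otimes>\<^bsub>A\<^esub> y) \<oplus>\<^bsub>A\<^esub> snd f (y \<otimes>\<^bsub>A\<^esub> x) \<ominus>\<^bsub>A\<^esub> y \<otimes>\<^bsub>A\<^esub> snd f x"
    using x y by (simp_all add: f c)
next
  fix x f g
  assume x: "x \<in> carrier A" and "f \<in> carrier centroid_algebra" "g \<in> carrier centroid_algebra"
  then obtain S T where ST: "S \<in> centroid F A" "T \<in> centroid F A"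
    and fg: "f = (S, S)" "g = (T, T)" by auto
  show "fst (f \<otimes>\<^bsub>centroid_algebra\<^esub> g) x =
      fst f (fst g x) \<oplus>\<^bsub>A\<^esub> fst f (snd g x) \<ominus>\<^bsub>A\<^esub> snd g (fst f x)"
    and "snd (f \<otimes>\<^bsub>centroid_algebra\<^esub> g) x =
      snd g (snd f x) \<oplus>\<^bsub>A\<^esub> snd g (fst f x) \<ominus>\<^bsub>A\<^esub> fst f (snd g x)"
    and "snd g (snd f x) = snd (f \<otimes>\<^bsub>centroid_algebra\<^esub> g) x
      \<oplus>\<^bsub>A\<^esub> snd (g \<otimes>\<^bsub>centroid_algebra\<^esub> f) x \<ominus>\<^bsub>A\<^esub> snd f (snd g x)"
    and "fst f (fst g x) = fst (f \<otimes>\<^bsub>centroid_algebra\<^esub> g) x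
      \<oplus>\<^bsub>A\<^esub> fst (g \<otimes>\<^bsub>centroid_algebra\<^esub> f) x \<ominus>\<^bsub>A\<^esub> fst g (fst f x)"
    using x ST centroid_commute[OF ST x] by (simp_all add: fg centroidD(1))
qed

section \<open>Derived actions are given by centroid elements\<close>

lemma derived_action_centroid:
  fixes B :: "('f, 'b, 'k) module_scheme"
  assumes "derived_action F B A l r" and b: "b \<in> carrier B"
  shows derived_action_symmetric: "x \<in> carrier A \<Longrightarrow> l b x = r x b"
    and derived_action_in_centroid: "restrict (l b) (carrier A) \<in> centroid F A"
proof -
  interpret D: derived_action F B A l r by fact
  have lc [simp]: "l b x \<in> carrier A" and rc [simp]: "r x b \<in> carrier A" if "x \<in> carrier A" for x
    using D.l_bilinear D.r_bilinear that b by (auto simp: bilinear_map_def)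
  have ladd: "l b (x \<oplus>\<^bsub>A\<^esub> y) = l b x \<oplus>\<^bsub>A\<^esub> l b y"
    and radd: "r (x \<oplus>\<^bsub>A\<^esub> y) b = r x b \<oplus>\<^bsub>A\<^esub> r y b" if "x \<in> carrier A" "y \<in> carrier A" for x y
    using D.l_bilinear D.r_bilinear that b by (auto simp: bilinear_map_def)
  have l0: "l b \<zero>\<^bsub>A\<^esub> = \<zero>\<^bsub>A\<^esub>" by (rule additive_zero) (auto simp: ladd)
  have lneg: "l b (\<ominus>\<^bsub>A\<^esub> x) = \<ominus>\<^bsub>A\<^esub> l b x" if "x \<in> carrier A" for x
    by (rule additive_neg) (auto simp: ladd that)
  have r0: "r \<zero>\<^bsub>A\<^esub> b = \<zero>\<^bsub>A\<^esub>" by (rule additive_zero[of "\<lambda>x. r x b"]) (auto simp: radd)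
  \<comment> \<open>In \<open>der3\<close> the terms b(xy) + b(yx) combine to b applied to xy + yx =
    0. The same argument with \<open>der4\<close> gives \<open>r_swap\<close>.\<close>
  have l_swap: "l b x \<otimes>\<^bsub>A\<^esub> y = \<ominus>\<^bsub>A\<^esub> (l b y \<otimes>\<^bsub>A\<^esub> x)" if "x \<in> carrier A" "y \<in> carrier A" for x y
    using D.der3[OF b that] that by (simp add: a_minus_def mult_add_swap l0 flip: ladd)
  have r_swap: "x \<otimes>\<^bsub>A\<^esub> r y b = \<ominus>\<^bsub>A\<^esub> (y \<otimes>\<^bsub>A\<^esub> r x b)" if "x \<in> carrier A" "y \<in> carrier A" for x y
    using D.der4[OF b that] that by (simp add: a_minus_def mult_add_swap r0 flip: radd)
  \<comment> \<open>By anticommutativity and \<open>l_swap\<close>, x(by) = (bx)y, so the first and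
    last terms on the right of \<open>der1\<close> cancel. In \<open>der2\<close> it is x(yb) that
    cancels against (xb)y, by \<open>r_swap\<close>.\<close>
  have l_mult: "l b (x \<otimes>\<^bsub>A\<^esub> y) = r x b \<otimes>\<^bsub>A\<^esub> y" if xy: "x \<in> carrier A" "y \<in> carrier A" for x y
    using D.der1[OF b xy] mult_anticomm[of x "l b y"] l_swap[OF xy] xy by simp
  have r_mult: "r (x \<otimes>\<^bsub>A\<^esub> y) b = x \<otimes>\<^bsub>A\<^esub> l b y" if xy: "x \<in> carrier A" "y \<in> carrier A" for x y
    using D.der2[OF b xy] mult_anticomm[of "r x b" y] r_swap[OF xy] xy by simp
  have l_mult': "l b (x \<otimes>\<^bsub>A\<^esub> y) = x \<otimes>\<^bsub>A\<^esub> r y b" if xy: "x \<in> carrier A" "y \<in> carrier A" for x y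
    using l_mult[OF xy] mult_anticomm[of "r x b" y] r_swap[OF xy] xy by simp
  have r_mult': "r (x \<otimes>\<^bsub>A\<^esub> y) b = l b x \<otimes>\<^bsub>A\<^esub> y" if xy: "x \<in> carrier A" "y \<in> carrier A" for x y
    using r_mult[OF xy] mult_anticomm[of x "l b y"] l_swap[OF xy] xy by simp
  show sym: "l b x = r x b" if x: "x \<in> carrier A" for x
  \<comment> \<open>Products yz are needed as test elements because \<open>mult_left_swap\<close>
    concerns threefold products. Moving y in front of bx produces (bx)z = (xz)b, and
    \<open>l_mult'\<close> turns this right action back into a left action on y(xz); swapping x and
    y again brings b next to x as a right action.\<close>
  proof (rule mult_mult_right_cancel)
    fix y z assume y: "y \<in> carrier A" and z: "z \<in> carrier A"
    have "l b x \<otimes>\<^bsub>A\<^esub> (y \<otimes>\<^bsub>A\<^esub> z) = \<ominus>\<^bsub>A\<^esub> (y \<otimes>\<^bsub>A\<^esub> r (x \<otimes>\<^bsub>A\<^esub> z) b)"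
      using x y z by (simp add: r_mult' mult_left_swap[of "l b x"])
    also have "\<dots> = l b (\<ominus>\<^bsub>A\<^esub> (y \<otimes>\<^bsub>A\<^esub> (x \<otimes>\<^bsub>A\<^esub> z)))"
      using x y z by (simp add: lneg l_mult'[of y])
    also have "\<dots> = l b (x \<otimes>\<^bsub>A\<^esub> (y \<otimes>\<^bsub>A\<^esub> z))"
      using mult_left_swap[OF x y z] by simp
    also have "\<dots> = r x b \<otimes>\<^bsub>A\<^esub> (y \<otimes>\<^bsub>A\<^esub> z)"
      using x y z by (simp add: l_mult)
    finally show "l b x \<otimes>\<^bsub>A\<^esub> (y \<otimes>\<^bsub>A\<^esub> z) = r x b \<otimes>\<^bsub>A\<^esub> (y \<otimes>\<^bsub>A\<^esub> z)" .
  qed (use x in auto)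
  show "restrict (l b) (carrier A) \<in> centroid F A"
  proof (rule restrict_in_centroid)
    show "l b (k \<odot>\<^bsub>A\<^esub> x) = k \<odot>\<^bsub>A\<^esub> l b x" if "k \<in> carrier F" "x \<in> carrier A" for k x
      using D.l_bilinear b that by (auto simp: bilinear_map_def)
    show "l b (x \<otimes>\<^bsub>A\<^esub> y) = l b x \<otimes>\<^bsub>A\<^esub> y" and "l b (x \<otimes>\<^bsub>A\<^esub> y) = x \<otimes>\<^bsub>A\<^esub> l b y"
      if "x \<in> carrier A" "y \<in> carrier A" for x y
      using l_mult[OF that] l_mult'[OF that] sym that by simp_all
  qed (auto simp: ladd)
qed

section \<open>Identification of \<open>usga F A\<close> with the centroid\<close>

lemma induced_pairs_subset_centroid: "induced_pairs F A \<subseteq> carrier centroid_algebra"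
proof
  fix f assume "f \<in> induced_pairs F A"
  then obtain B :: "('f, 'a mpair) module" and l r b
    where B: "derived_action F B A l r" "b \<in> carrier B" and f: "f = act_pair A l r b"
    by (auto simp: induced_pairs_def)
  have "f = (restrict (l b) (carrier A), restrict (l b) (carrier A))"
    by (auto simp: f act_pair_def derived_action_symmetric[OF B] intro!: restrict_ext)
  then show "f \<in> carrier centroid_algebra"
    using derived_action_in_centroid[OF B] by simp
qed

text \<open>The centroid algebra is itself one of the acting algebras, and its element
  \<open>f\<close> induces the pair \<open>f\<close>.\<close>

lemma centroid_subset_induced_pairs: "carrier centroid_algebra \<subseteq> induced_pairs F A"
proof
  fix f assume f: "f \<in> carrier centroid_algebra"
  have "act_pair A fst (\<lambda>a f. snd f a) f = f"
    using f by (auto simp: act_pair_def centroidD(6) extensional_restrict)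
  with act_pair_in_induced_pairs[OF centroid_algebra_derived_action f]
  show "f \<in> induced_pairs F A" by simp
qed

text \<open>The induced pairs are exactly the diagonal centroid pairs. These are already closed
  under sum, negation and product, so generation adds nothing.\<close>

lemma usga_eq_centroid_algebra: "usga F A = centroid_algebra"
proof -
  have "f \<in> carrier centroid_algebra" if "f \<in> usga_carrier F A" for f
    using that
  proof induction
    case (base f)
    then show ?case using induced_pairs_subset_centroid by blast
  next
    case (add f g)
    then show ?case by (auto simp: pair_add_def centroid_add)
  next
    case (neg f)
    then show ?case by (auto simp: pair_neg_def centroid_uminus)
  next
    case (mult f g)
    then show ?case by (auto simp: centroid_pair_mult centroid_comp)
  qed
  then have "usga_carrier F A = carrier centroid_algebra"
    using centroid_subset_induced_pairs by (blast intro: usga_carrier.base)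
  then show ?thesis by (simp add: centroid_algebra_def usga_def)
qed

end

section \<open>The universal property\<close>

text \<open>Multiplicativity is \<open>der5\<close> and \<open>der6\<close>, whose right-hand sides
  are the two components of \<open>pair_mult\<close>; linearity is bilinearity of the
  action.\<close>

lemma act_pair_hom_usga:
  fixes C :: "('f, 'c, 'k) module_scheme" and A :: "('f, 'a, 'm) module_scheme"
  assumes "derived_action F C A l r"
  shows "restrict (act_pair A l r) (carrier C) \<in> algebra_hom F C (usga F A)"
proof -
  interpret derived_action F C A l r by fact
  have lc: "l x a \<in> carrier A" and rc: "r a x \<in> carrier A" if "x \<in> carrier C" "a \<in> carrier A" for x a
    using l_bilinear r_bilinear that by (auto simp: bilinear_map_def)
  show ?thesis
    using act_pair_in_induced_pairs[OF assms] l_bilinear r_bilinear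
    by (auto simp: algebra_hom_def usga_def act_pair_def pair_add_def pair_smult_def pair_mult_def
        bilinear_map_def der5 der6 lc rc intro!: restrict_ext usga_carrier.base)
qed

lemma (in centreless_anticommutative_galt_algebra) usga_is_actor:
  "is_actor TYPE('c) F A (usga F A) fst (\<lambda>a f. snd f a)"
  unfolding is_actor_def
proof (intro conjI allI impI)
  show "derived_action F (usga F A) A fst (\<lambda>a f. snd f a)"
    unfolding usga_eq_centroid_algebra by (rule centroid_algebra_derived_action)
next
  fix C :: "('f, 'c) module" and l r
  assume C: "derived_action F C A l r"
  let ?P = "\<lambda>\<phi>. \<phi> \<in> algebra_hom F C (usga F A) \<inter> extensional (carrier C) \<and>
    (\<forall>c\<in>carrier C. \<forall>a\<in>carrier A. l c a = fst (\<phi> c) a \<and> r a c = snd (\<phi> c) a)"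
  show "\<exists>!\<phi>. ?P \<phi>"
  \<comment> \<open>Each c is sent to the pair of maps by which it acts. Restricting to
    \<open>carrier C\<close> provides the extensionality demanded by
    \<open>is_actor\<close>.\<close>
  proof (rule ex1I[of _ "restrict (act_pair A l r) (carrier C)"])
    show "?P (restrict (act_pair A l r) (carrier C))"
      using act_pair_hom_usga[OF C] by (simp add: act_pair_def)
  next
    fix \<phi> assume \<phi>: "?P \<phi>"
    show "\<phi> = restrict (act_pair A l r) (carrier C)"
    proof (rule extensionalityI[of _ "carrier C"])
      fix c assume c: "c \<in> carrier C"
      then have "\<phi> c \<in> carrier (usga F A)" using \<phi> by (auto simp: algebra_hom_def)
      then obtain T where T: "T \<in> centroid F A" "\<phi> c = (T, T)"
        by (auto simp: usga_eq_centroid_algebra)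
      \<comment> \<open>Uniqueness: the values of T on \<open>carrier A\<close> are prescribed by
        the action of c, and T is extensional, so nothing about it remains free.\<close>
      then have "(T, T) = act_pair A l r c"
        using \<phi> c centroidD(6)[OF T(1)]
        by (auto simp: act_pair_def intro!: extensionalityI[of _ "carrier A"])
      with T c show "\<phi> c = restrict (act_pair A l r) (carrier C) c" by simp
    qed (use \<phi> in auto)
  qed
qed

theorem corollary6p3:
  fixes F :: "('f, 'n) ring_scheme" and A :: "('f, 'a, 'm) module_scheme"
  assumes "galt_algebra F A"
    and "anticommutative A"
    and "Ann A = {\<zero>\<^bsub>A\<^esub>}"
  shows "(\<exists>(Act :: ('f, 'a mpair) module) l r. is_actor TYPE('c) F A Act l r) \<and>
         is_actor TYPE('c) F A (usga F A) fst (\<lambda>a f. snd f a)"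
proof -
  interpret centreless_anticommutative_galt_algebra F A
    using assms by (simp add: centreless_anticommutative_galt_algebra_def
        centreless_anticommutative_galt_algebra_axioms_def)
  show ?thesis using usga_is_actor by blast
qed

end
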